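(* For every integer $n\ge 1$ and every finite set $A\subset\mathbb{R}^n$, letting $m:=|A|$, we have $\lambda_n(A)\ge\lambda_n(m)$. Moreover, if $m=(K+1)^iK^{n-i}$ with integers $K\ge 1$ and $i\in[0,n]$, then equality is attained if and only if $A$ is the Cartesian product of $i$ real sets of size $K+1$ and $n-i$ real sets of size $K$; that is, if and only if $A=S_1\times\dotsb\times S_n$ with $S_1,\ldots,S_n\subset\mathbb{R}$, where exactly $i$ of the sets $S_j$ (not necessarily the first $i$) have size $K+1$ and the remaining $n-i$ have size $K$.
   Context: $\mathbb{N}_0$ denotes the set of all non-negative integers, and $[a,b]$ denotes the set of integers from $a$ to $b$. For $i\in[1,n]$, $\rho_i$ is the orthogonal projection of $\mathbb{R}^n$ onto the $i$-th coordinate axis (the span of the coordinate vector $e_i$). For a finite set $A\subset\mathbb{R}^n$ let $\lambda_n(A):=\sum_{i=1}^n|\rho_i(A)|$. The cube order on $\mathbb{N}_0^n$ is the linear order in which $(x_1,\ldots,x_n)$ precedes $(y_1,\ldots,y_n)$ if there exist $l_0\in\mathbb{N}_0$ and $j\in[1,n]$ such that $\{i\in[1,n]: x_i=l\}=\{i\in[1,n]: y_i=l\}$ for each $l>l_0$, and also $\{i\in[j+1,n]: x_i=l_0\}=\{i\in[j+1,n]: y_i=l_0\}$, while $x_j<y_j=l_0$. For an integer $m\ge 0$, $\mathcal{I}_n(m)\subset\mathbb{N}_0^n$ denotes the length-$m$ initial segment of $\mathbb{N}_0^n$ with respect to the cube order, that is, the set of the $m$ smallest elements (with $\mathcal{I}_n(0)=\varnothing$),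 and $\lambda_n(m):=\lambda_n(\mathcal{I}_n(m))$. *)

theory Defs
  imports Complex_Main "HOL-Library.FuncSet"
begin

text \<open>Vectors of length \<open>n\<close> are extensional functions on \<open>{1..n}\<close>, so that \<open>n\<close> is an ordinary
  natural number and a Cartesian product \<open>S 1 \<times> \<dots> \<times> S n\<close> is literally \<open>PiE {1..n} S\<close>.\<close>

definition real_vecs :: "nat \<Rightarrow> (nat \<Rightarrow> real) set" where
  "real_vecs n = {1..n} \<rightarrow>\<^sub>E UNIV"

definition nat_vecs :: "nat \<Rightarrow> (nat \<Rightarrow> nat) set" where
  "nat_vecs n = {1..n} \<rightarrow>\<^sub>E UNIV"

definition unit_vec :: "nat \<Rightarrow> nat \<Rightarrow> nat \<Rightarrow> real" where
  "unit_vec n i = (\<lambda>j\<in>{1..n}. if j = i then 1 else 0)"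

text \<open>The inner product of \<open>x\<close> with the \<open>i\<close>-th unit vector is \<open>x i\<close>, so this is the orthogonal
  projection onto the line spanned by that unit vector.\<close>

definition axis_proj :: "nat \<Rightarrow> nat \<Rightarrow> (nat \<Rightarrow> real) \<Rightarrow> nat \<Rightarrow> real" where
  "axis_proj n i x = (\<lambda>j\<in>{1..n}. x i * unit_vec n i j)"

definition proj_sum :: "nat \<Rightarrow> (nat \<Rightarrow> real) set \<Rightarrow> nat" where
  "proj_sum n A = (\<Sum>i=1..n. card (axis_proj n i ` A))"

definition cube_less :: "nat \<Rightarrow> (nat \<Rightarrow> nat) \<Rightarrow> (nat \<Rightarrow> nat) \<Rightarrow> bool" where
  "cube_less n x y \<longleftrightarrow>
     (\<exists>l0. \<exists>j\<in>{1..n}.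
        (\<forall>l>l0. {i\<in>{1..n}. x i = l} = {i\<in>{1..n}. y i = l}) \<and>
        {i\<in>{j+1..n}. x i = l0} = {i\<in>{j+1..n}. y i = l0} \<and>
        x j < y j \<and> y j = l0)"

definition is_cube_segment :: "nat \<Rightarrow> nat \<Rightarrow> (nat \<Rightarrow> nat) set \<Rightarrow> bool" where
  "is_cube_segment n m I \<longleftrightarrow>
     I \<subseteq> nat_vecs n \<and> finite I \<and> card I = m \<and>
     (\<forall>y\<in>I. \<forall>x\<in>nat_vecs n. cube_less n x y \<longrightarrow> x \<in> I)"

text \<open>For \<open>n \<ge> 1\<close> the description is proper; see \<open>cube_segment_ex1\<close> below.\<close>

definition cube_segment :: "nat \<Rightarrow> nat \<Rightarrow> (nat \<Rightarrow> nat) set" where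
  "cube_segment n m = (THE I. is_cube_segment n m I)"

definition real_vec :: "nat \<Rightarrow> (nat \<Rightarrow> nat) \<Rightarrow> nat \<Rightarrow> real" where
  "real_vec n x = (\<lambda>i\<in>{1..n}. real (x i))"

definition proj_sum_segment :: "nat \<Rightarrow> nat \<Rightarrow> nat" where
  "proj_sum_segment n m = proj_sum n (real_vec n ` cube_segment n m)"

lemma cube_less_iff:
  "cube_less n x y \<longleftrightarrow>
     (\<exists>j\<in>{1..n}. x j < y j \<and>
        (\<forall>i\<in>{1..n}. (x i > y j \<or> y i > y j) \<longrightarrow> x i = y i) \<and>
        (\<forall>i\<in>{j+1..n}. x i = y j \<longleftrightarrow> y i = y j))"
proof -
  have "(\<forall>l>l0. {i\<in>{1..n}. x i = l} = {i\<in>{1..n}. y i = l}) \<longleftrightarrow>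
        (\<forall>i\<in>{1..n}. (x i > l0 \<or> y i > l0) \<longrightarrow> x i = y i)" for l0
  proof (intro iffI ballI impI)
    fix i assume *: "\<forall>l>l0. {i\<in>{1..n}. x i = l} = {i\<in>{1..n}. y i = l}" "i \<in> {1..n}"
      and "x i > l0 \<or> y i > l0"
    then consider "x i > l0" | "y i > l0" by blast
    then show "x i = y i"
    proof cases
      case 1
      with *(1) have "i \<in> {k\<in>{1..n}. x k = x i} \<longleftrightarrow> i \<in> {k\<in>{1..n}. y k = x i}" by blast
      with *(2) show ?thesis by simp
    next
      case 2
      with *(1) have "i \<in> {k\<in>{1..n}. x k = y i} \<longleftrightarrow> i \<in> {k\<in>{1..n}. y k = y i}" by blast
      with *(2) show ?thesis by simp
    qed
  next
    assume R: "\<forall>i\<in>{1..n}. x i > l0 \<or> y i > l0 \<longrightarrow> x i = y i"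
    show "\<forall>l>l0. {i\<in>{1..n}. x i = l} = {i\<in>{1..n}. y i = l}"
    proof (intro allI impI Collect_cong conj_cong refl)
      fix l i assume "l > l0" "i \<in> {1..n}"
      then show "x i = l \<longleftrightarrow> y i = l" using R by (metis (full_types))
    qed
  qed
  note levels = this
  have right: "{i\<in>{j+1..n}. x i = l0} = {i\<in>{j+1..n}. y i = l0} \<longleftrightarrow>
        (\<forall>i\<in>{j+1..n}. x i = l0 \<longleftrightarrow> y i = l0)" for j l0
    by blast
  show ?thesis unfolding cube_less_def levels right by blast
qed

lemma cube_lessI:
  assumes "j \<in> {1..n}" "x j < y j" "y j = l"
    and above: "\<And>i. i \<in> {1..n} \<Longrightarrow> x i > l \<or> y i > l \<Longrightarrow> x i = y i"
    and right: "\<And>i. i \<in> {1..n} \<Longrightarrow> i > j \<Longrightarrow> x i = l \<longleftrightarrow> y i = l"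
  shows "cube_less n x y"
proof -
  have "\<forall>i\<in>{1..n}. x i > y j \<or> y i > y j \<longrightarrow> x i = y i"
    unfolding assms(3) using above by blast
  moreover have "\<forall>i\<in>{j+1..n}. x i = y j \<longleftrightarrow> y i = y j"
  proof
    fix i assume "i \<in> {j+1..n}"
    then have "i \<in> {1..n}" "i > j" by auto
    then show "x i = y j \<longleftrightarrow> y i = y j" unfolding assms(3) by (rule right)
  qed
  ultimately show ?thesis unfolding cube_less_iff using assms(1,2) by blast
qed

lemma cube_lessE:
  assumes "cube_less n x y"
  obtains j where "j \<in> {1..n}" "x j < y j"
    "\<forall>i\<in>{1..n}. x i > y j \<or> y i > y j \<longrightarrow> x i = y i"
    "\<forall>i\<in>{1..n}. i > j \<longrightarrow> (x i = y j \<longleftrightarrow> y i = y j)"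
proof -
  obtain j where j: "j \<in> {1..n}" "x j < y j"
    "\<forall>i\<in>{1..n}. x i > y j \<or> y i > y j \<longrightarrow> x i = y i"
    "\<forall>i\<in>{j+1..n}. x i = y j \<longleftrightarrow> y i = y j"
    using assms unfolding cube_less_iff by blast
  have "\<forall>i\<in>{1..n}. i > j \<longrightarrow> (x i = y j \<longleftrightarrow> y i = y j)"
  proof (intro ballI impI)
    fix i assume "i \<in> {1..n}" "i > j"
    then have "i \<in> {j+1..n}" by simp
    with j(4) show "x i = y j \<longleftrightarrow> y i = y j" by blast
  qed
  with j(1-3) show ?thesis by (rule that)
qed

lemma cube_less_irrefl: "\<not> cube_less n x x"
  unfolding cube_less_iff by auto

lemma cube_less_trans_aux1:
  fixes a b c p q i j k :: nat
  assumes less: "q < p \<or> q = p \<and> k < j"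
    and "a > p \<or> b > p \<longrightarrow> a = b" "b > q \<or> c > q \<longrightarrow> b = c"
    and j: "i > j \<longrightarrow> (a = p \<longleftrightarrow> b = p)" and k: "i > k \<longrightarrow> (b = q \<longleftrightarrow> c = q)"
  shows "(a > p \<or> c > p \<longrightarrow> a = c) \<and> (i > j \<longrightarrow> (a = p \<longleftrightarrow> c = p))"
proof -
  have ab: "a = b \<or> a \<le> p \<and> b \<le> p" and bc: "b = c \<or> b \<le> q \<and> c \<le> q"
    using assms(2,3) not_less by blast+
  have "a > p \<or> c > p \<longrightarrow> a = c" using less ab bc by (elim disjE conjE) simp_all
  moreover have "a = p \<longleftrightarrow> c = p" if "i > j"
  proof -
    have "b = p \<longleftrightarrow> c = p" using less
    proof
      assume "q < p"
      then show ?thesis using bc by (elim disjE conjE) simp_all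
    next
      assume "q = p \<and> k < j"
      with k that show ?thesis by simp
    qed
    with j that show ?thesis by simp
  qed
  ultimately show ?thesis by blast
qed

lemma cube_less_trans_aux2:
  fixes a b c p q i j k :: nat
  assumes less: "p < q \<or> q = p \<and> j < k"
    and "a > p \<or> b > p \<longrightarrow> a = b" "b > q \<or> c > q \<longrightarrow> b = c"
    and j: "i > j \<longrightarrow> (a = p \<longleftrightarrow> b = p)" and k: "i > k \<longrightarrow> (b = q \<longleftrightarrow> c = q)"
  shows "(a > q \<or> c > q \<longrightarrow> a = c) \<and> (i > k \<longrightarrow> (a = q \<longleftrightarrow> c = q))"
proof -
  have ab: "a = b \<or> a \<le> p \<and> b \<le> p" and bc: "b = c \<or> b \<le> q \<and> c \<le> q"
    using assms(2,3) not_less by blast+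
  have "a > q \<or> c > q \<longrightarrow> a = c" using less ab bc by (elim disjE conjE) simp_all
  moreover have "a = q \<longleftrightarrow> c = q" if "i > k"
  proof -
    have "a = q \<longleftrightarrow> b = q" using less
    proof
      assume "p < q"
      then show ?thesis using ab by (elim disjE conjE) simp_all
    next
      assume "q = p \<and> j < k"
      with j that show ?thesis by simp
    qed
    with k that show ?thesis by simp
  qed
  ultimately show ?thesis by blast
qed

lemma cube_less_trans:
  assumes "cube_less n x y" "cube_less n y z"
  shows "cube_less n x z"
proof -
  obtain j where j: "j \<in> {1..n}" "x j < y j"
    "\<forall>i\<in>{1..n}. x i > y j \<or> y i > y j \<longrightarrow> x i = y i"
    "\<forall>i\<in>{1..n}. i > j \<longrightarrow> (x i = y j \<longleftrightarrow> y i = y j)"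
    using assms(1) by (elim cube_lessE)
  obtain k where k: "k \<in> {1..n}" "y k < z k"
    "\<forall>i\<in>{1..n}. y i > z k \<or> z i > z k \<longrightarrow> y i = z i"
    "\<forall>i\<in>{1..n}. i > k \<longrightarrow> (y i = z k \<longleftrightarrow> z i = z k)"
    using assms(2) by (elim cube_lessE)
  have eq_y: "x i > y j \<or> y i > y j \<longrightarrow> x i = y i" "y i > z k \<or> z i > z k \<longrightarrow> y i = z i"
    "i > j \<longrightarrow> (x i = y j \<longleftrightarrow> y i = y j)" "i > k \<longrightarrow> (y i = z k \<longleftrightarrow> z i = z k)"
    if "i \<in> {1..n}" for i
    by (fact bspec[OF j(3) that] bspec[OF k(3) that] bspec[OF j(4) that] bspec[OF k(4) that])+
  show ?thesis
  proof (cases "z k < y j \<or> z k = y j \<and> k < j")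
    case True
    then have zj: "z j = y j" using eq_y(2,4)[OF j(1)] by auto
    have "(x i > y j \<or> z i > y j \<longrightarrow> x i = z i) \<and> (i > j \<longrightarrow> (x i = y j \<longleftrightarrow> z i = y j))"
      if "i \<in> {1..n}" for i
      by (rule cube_less_trans_aux1[OF True eq_y[OF that]])
    with zj j(2) show ?thesis by (intro cube_lessI[of j n x z "y j"] j(1)) auto
  next
    case False
    then have *: "z k > y j \<or> z k = y j \<and> j < k"
      using j(2) k(2) by (cases j k rule: linorder_cases) auto
    have xk: "x k = y k \<or> x k \<le> y j" using eq_y(1)[OF k(1)] not_less by blast
    have "x k < z k" using *
    proof
      assume "z k > y j"
      with xk k(2) show ?thesis by (elim disjE) simp_all
    next
      assume zk: "z k = y j \<and> j < k"
      with k(2) have "y k \<noteq> y j" by simp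
      with zk eq_y(3)[OF k(1)] have "x k \<noteq> y j" by blast
      with zk xk k(2) show ?thesis by (elim disjE) simp_all
    qed
    moreover have "(x i > z k \<or> z i > z k \<longrightarrow> x i = z i) \<and> (i > k \<longrightarrow> (x i = z k \<longleftrightarrow> z i = z k))"
      if "i \<in> {1..n}" for i
      by (rule cube_less_trans_aux2[OF * eq_y[OF that]])
    ultimately show ?thesis by (intro cube_lessI[of k n x z "z k"] k(1)) auto
  qed
qed

lemma cube_less_total:
  assumes "x \<in> nat_vecs n" "y \<in> nat_vecs n" "x \<noteq> y"
  shows "cube_less n x y \<or> cube_less n y x"
proof -
  define D where "D = {i\<in>{1..n}. x i \<noteq> y i}"
  have "finite D" by (simp add: D_def)
  have "D \<noteq> {}"
    using PiE_ext[OF assms(1,2)[unfolded nat_vecs_def]] assms(3) by (auto simp: D_def)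
  define l where "l = Max ((\<lambda>i. max (x i) (y i)) ` D)"
  have le: "max (x i) (y i) \<le> l" if "i \<in> D" for i
    using that \<open>finite D\<close> by (simp add: l_def del: max.bounded_iff)
  define E where "E = {i\<in>D. max (x i) (y i) = l}"
  have "l \<in> (\<lambda>i. max (x i) (y i)) ` D"
    unfolding l_def using \<open>finite D\<close> \<open>D \<noteq> {}\<close> by (intro Max_in) auto
  then have "E \<noteq> {}" by (auto simp: E_def)
  moreover have "finite E" using \<open>finite D\<close> by (simp add: E_def)
  ultimately have jE: "Max E \<in> E" and jmax: "\<And>i. i \<in> E \<Longrightarrow> i \<le> Max E" by auto
  define j where "j = Max E"
  have j: "j \<in> {1..n}" "x j \<noteq> y j" "max (x j) (y j) = l"
    using jE[folded j_def] unfolding E_def D_def by simp_all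
  have above: "x i = y i" if "i \<in> {1..n}" "x i > l \<or> y i > l" for i
    using le[of i] that by (cases "x i = y i") (auto simp: D_def)
  have right: "x i = l \<longleftrightarrow> y i = l" if "i \<in> {1..n}" "i > j" for i
  proof (rule ccontr)
    assume "(x i = l) \<noteq> (y i = l)"
    then have "i \<in> D" using that by (auto simp: D_def)
    with le[of i] \<open>(x i = l) \<noteq> (y i = l)\<close> have "i \<in> E" by (auto simp: E_def max_def split: if_splits)
    with jmax[of i] that show False by (simp add: j_def)
  qed
  show ?thesis
  proof (cases "x j < y j")
    case True
    then have "y j = l" using j by simp
    have "cube_less n x y"
      by (rule cube_lessI[of j n x y, OF j(1) True \<open>y j = l\<close>]) (metis above right)+
    then show ?thesis ..
  next
    case False
    then have "y j < x j" "x j = l" using j by auto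
    have "cube_less n y x"
      by (rule cube_lessI[of j n y x, OF j(1) \<open>y j < x j\<close> \<open>x j = l\<close>]) (metis above right)+
    then show ?thesis ..
  qed
qed

lemma finite_cube_preds: "finite {x \<in> nat_vecs n. cube_less n x y}"
proof (rule finite_subset)
  define M where "M = Max (y ` {1..n})"
  have M: "y i \<le> M" if "i \<in> {1..n}" for i using that by (simp add: M_def)
  show "{x \<in> nat_vecs n. cube_less n x y} \<subseteq> {1..n} \<rightarrow>\<^sub>E {..M}"
  proof
    fix x assume "x \<in> {x \<in> nat_vecs n. cube_less n x y}"
    then have x: "x \<in> nat_vecs n" "cube_less n x y" by auto
    from x(2) obtain j where j: "j \<in> {1..n}"
      "\<And>i. i \<in> {1..n} \<Longrightarrow> x i > y j \<Longrightarrow> x i = y i"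
      unfolding cube_less_iff by blast
    have "x i \<le> M" if "i \<in> {1..n}" for i
      using M[OF that] M[OF j(1)] j(2)[OF that] by linarith
    with x(1) show "x \<in> {1..n} \<rightarrow>\<^sub>E {..M}" by (auto simp: nat_vecs_def PiE_iff)
  qed
qed (simp add: finite_PiE)

lemma infinite_nat_vecs:
  assumes "n \<ge> 1" shows "infinite (nat_vecs n)"
proof
  assume "finite (nat_vecs n)"
  moreover have "(\<lambda>k. \<lambda>i\<in>{1..n}. k) ` (UNIV :: nat set) \<subseteq> nat_vecs n"
    by (auto simp: nat_vecs_def)
  ultimately have "finite ((\<lambda>k. \<lambda>i\<in>{1..n}. k) ` (UNIV :: nat set))"
    by (rule rev_finite_subset)
  moreover have "inj (\<lambda>k::nat. \<lambda>i\<in>{1..n}. k)"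
    using assms by (auto simp: inj_def fun_eq_iff)
  ultimately show False using finite_imageD by blast
qed

lemma is_cube_segment_unique:
  assumes "is_cube_segment n m I" "is_cube_segment n m J"
  shows "I = J"
proof -
  have "I \<subseteq> J \<or> J \<subseteq> I"
  proof (rule ccontr)
    assume "\<not> (I \<subseteq> J \<or> J \<subseteq> I)"
    then obtain a b where ab: "a \<in> I" "a \<notin> J" "b \<in> J" "b \<notin> I" by auto
    then have "a \<in> nat_vecs n" "b \<in> nat_vecs n" "a \<noteq> b"
      using assms by (auto simp: is_cube_segment_def)
    with cube_less_total[of a n b] ab assms show False
      unfolding is_cube_segment_def by blast
  qed
  then show ?thesis
    using assms card_subset_eq unfolding is_cube_segment_def by metis
qed

lemma is_cube_segment_ex:
  assumes "n \<ge> 1" shows "\<exists>I. is_cube_segment n m I"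
proof (induction m)
  case 0
  show ?case by (rule exI[of _ "{}"]) (simp add: is_cube_segment_def)
next
  case (Suc m)
  then obtain I where I: "I \<subseteq> nat_vecs n" "finite I" "card I = m"
    "\<And>x y. y \<in> I \<Longrightarrow> x \<in> nat_vecs n \<Longrightarrow> cube_less n x y \<Longrightarrow> x \<in> I"
    unfolding is_cube_segment_def by blast
  define r where "r y = card {x \<in> nat_vecs n. cube_less n x y}" for y
  have r: "r x < r y" if "x \<in> nat_vecs n" "cube_less n x y" for x y
    unfolding r_def
  proof (rule psubset_card_mono[OF finite_cube_preds])
    show "{z \<in> nat_vecs n. cube_less n z x} \<subset> {z \<in> nat_vecs n. cube_less n z y}"
      using that cube_less_trans cube_less_irrefl by blast
  qed
  obtain z where "z \<in> nat_vecs n - I"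
    using infinite_nat_vecs[OF assms] \<open>finite I\<close> by (metis Diff_infinite_finite ex_in_conv finite.emptyI)
  then obtain y where y: "y \<in> nat_vecs n - I" "\<And>x. x \<in> nat_vecs n - I \<Longrightarrow> r y \<le> r x"
    using ex_has_least_nat[of "\<lambda>x. x \<in> nat_vecs n - I" z r] by blast
  have "is_cube_segment n (Suc m) (insert y I)"
    unfolding is_cube_segment_def
  proof (intro conjI ballI impI)
    fix u x assume u: "u \<in> insert y I" and x: "x \<in> nat_vecs n" "cube_less n x u"
    show "x \<in> insert y I"
    proof (cases "u = y")
      case True
      with r[OF x] y(2)[of x] x(1) show ?thesis by fastforce
    qed (use u x I(4) in blast)
  qed (use I y in auto)
  then show ?case ..
qed

lemma cube_segment_ex1: "n \<ge> 1 \<Longrightarrow> \<exists>!I. is_cube_segment n m I"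
  using is_cube_segment_ex is_cube_segment_unique by (metis (full_types))

lemma is_cube_segment_cube_segment: "n \<ge> 1 \<Longrightarrow> is_cube_segment n m (cube_segment n m)"
  unfolding cube_segment_def by (rule theI'[OF cube_segment_ex1])

end

theory Submission
  imports Defs
begin

text \<open>Let \<open>a j\<close> be the number of values taken by the \<open>j\<close>-th coordinate on \<open>A\<close>. Then
  \<open>proj_sum n A\<close> is the sum of the \<open>a j\<close>, and \<open>A\<close> lies in the product of its coordinate sets,
  whence \<open>card A \<le> (\<Prod>j. a j)\<close> with equality only if \<open>A\<close> is that product. Everything thus
  rests on the largest product of \<open>n\<close> natural numbers with a prescribed sum \<open>n * K + i\<close>, where
  \<open>K \<ge> 1\<close> and \<open>i \<le> n\<close>: it is \<open>(K + 1) ^ i * K ^ (n - i)\<close>, attained only by \<open>i\<close> copies of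
  \<open>K + 1\<close> and \<open>n - i\<close> copies of \<open>K\<close> (\<open>prod_le_balanced\<close>, \<open>prod_balanced_imp\<close>). Instead of
  moving units between factors one compares every factor with its bound separately: with
  \<open>r = K / (K + 1)\<close>, the function \<open>x * r ^ x\<close> on the natural numbers is largest precisely at
  \<open>K\<close> and \<open>K + 1\<close>, and the powers of \<open>r\<close> multiply to something that depends only on the sum.

  On the other side, the box whose first \<open>i\<close> sides are \<open>{..<K + 1}\<close> and whose other sides are
  \<open>{..<K}\<close> is an initial segment of the cube order (\<open>is_cube_segment_box\<close>); its projection sum
  is \<open>n * K + i\<close> and its size is the extremal product. Every coordinate of a nonempty \<open>A\<close>
  takes a value, so the projection sum of \<open>A\<close> is at least \<open>n\<close> and has the form
  \<open>n * K + i\<close> with \<open>K \<ge> 1\<close> and \<open>i \<le> n\<close>; the initial segment of length \<open>card A\<close> then fits into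
  that box, which gives the inequality. When \<open>card A\<close> is itself an extremal product, the segment is the box, and the
  equality cases of the two estimates determine \<open>A\<close>.\<close>


section \<open>The largest product of natural numbers with a given sum\<close>

lemma geometric_weight_less:
  fixes K a :: nat
  assumes K: "K \<ge> 1" and a: "a \<noteq> K" "a \<noteq> K + 1"
  defines "r \<equiv> real K / real (K + 1)"
  shows "real a * r ^ a < real K * r ^ K"
proof -
  have r: "r > 0" using K by (simp add: r_def)
  \<comment> \<open>By the sign of \<open>K - b\<close>, the values rise up to \<open>K\<close>, agree at \<open>K\<close> and \<open>K + 1\<close>, and
    fall from there on; this shape, and the tie, is what the choice of \<open>r\<close> is made for.\<close>
  have step: "real (b + 1) * r ^ (b + 1) - real b * r ^ b
      = r ^ b * (real K - real b) / real (K + 1)" for b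
  proof -
    have "(real (b + 1) * r - real b) * real (K + 1)
        = real (b + 1) * (r * real (K + 1)) - real b * real (K + 1)"
      by (simp only: left_diff_distrib mult.assoc)
    also have "r * real (K + 1) = real K" by (simp add: r_def)
    also have "real (b + 1) * real K - real b * real (K + 1) = real K - real b"
      by (simp add: algebra_simps)
    finally have "(real (b + 1) * r - real b) * real (K + 1) = real K - real b" .
    then have "real (b + 1) * r - real b = (real K - real b) / real (K + 1)"
      by (simp add: eq_divide_eq)
    moreover have "real (b + 1) * r ^ (b + 1) - real b * r ^ b
        = r ^ b * (real (b + 1) * r - real b)"
      by (simp add: algebra_simps)
    ultimately show ?thesis by simp
  qed
  have up: "real b * r ^ b < real (b + 1) * r ^ (b + 1)" if "b < K" for b
  proof -
    have "0 < r ^ b * (real K - real b) / real (K + 1)" using r that by simp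
    then show ?thesis using step[of b] by linarith
  qed
  have down: "real (b + 1) * r ^ (b + 1) < real b * r ^ b" if "b > K" for b
  proof -
    have "r ^ b * (real K - real b) / real (K + 1) < 0"
      using r that by (simp add: divide_less_0_iff mult_less_0_iff)
    then show ?thesis using step[of b] by linarith
  qed
  have top: "real (K + 1) * r ^ (K + 1) = real K * r ^ K"
    using step[of K] by simp
  show ?thesis
  proof (cases "a < K")
    case True
    have "real a * r ^ a < real (Suc b) * r ^ Suc b" if "a \<le> b" "b < K" for b
      using that
    proof (induction b rule: dec_induct)
      case base
      then show ?case using up[of a] by simp
    next
      case (step b)
      then show ?case using up[of "Suc b"] by simp
    qed
    from this[of "K - 1"] True show ?thesis by simp
  next
    case False
    with a have "K + 1 \<le> a" "a \<noteq> K + 1" by simp_all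
    have "real (Suc b) * r ^ Suc b < real (K + 1) * r ^ (K + 1)" if "K + 1 \<le> b" for b
      using that
    proof (induction b rule: dec_induct)
      case base
      then show ?case using down[of "K + 1"] by simp
    next
      case (step b)
      then show ?case using down[of "Suc b"] by simp
    qed
    from this[of "a - 1"] \<open>K + 1 \<le> a\<close> \<open>a \<noteq> K + 1\<close>
    have "real (Suc (a - 1)) * r ^ Suc (a - 1) < real (K + 1) * r ^ (K + 1)"
      by linarith
    also have "Suc (a - 1) = a" using \<open>K + 1 \<le> a\<close> by simp
    finally show ?thesis using top by metis
  qed
qed

lemma geometric_weight_le:
  fixes K a :: nat
  assumes "K \<ge> 1"
  defines "r \<equiv> real K / real (K + 1)"
  shows "real a * r ^ a \<le> real K * r ^ K"
proof (cases "a = K \<or> a = K + 1")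
  case True
  then show ?thesis by (auto simp: r_def field_simps)
next
  case False
  then show ?thesis using geometric_weight_less[OF assms(1)] unfolding r_def
    by (simp add: less_imp_le)
qed

text \<open>Expresses a product of factors of known sum through the weighted factors of the previous
  lemmas: the weights themselves multiply to a power that only sees the sum.\<close>

lemma prod_eq_weighted_prod:
  fixes a :: "nat \<Rightarrow> nat" and K i :: nat
  assumes K: "K \<ge> 1" and i: "i \<le> card J" and s: "(\<Sum>j\<in>J. a j) = card J * K + i"
  defines "r \<equiv> real K / real (K + 1)"
  shows "(\<Prod>j\<in>J. real (a j) * r ^ a j)
    = real (\<Prod>j\<in>J. a j) * (r ^ (card J * K) * r ^ i)"
    and "(\<Prod>j\<in>J. real K * r ^ K)
    = real ((K + 1) ^ i * K ^ (card J - i)) * (r ^ (card J * K) * r ^ i)"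
proof -
  show "(\<Prod>j\<in>J. real (a j) * r ^ a j)
      = real (\<Prod>j\<in>J. a j) * (r ^ (card J * K) * r ^ i)"
    by (simp add: prod.distrib flip: power_sum power_add s)
  have "real K ^ card J = real K ^ (card J - i) * real K ^ i"
    using i by (simp flip: power_add)
  moreover have "real K ^ i = real (K + 1) ^ i * r ^ i"
    by (simp add: r_def flip: power_mult_distrib)
  ultimately have "real K ^ card J = real ((K + 1) ^ i * K ^ (card J - i)) * r ^ i"
    by simp
  moreover have "(\<Prod>j\<in>J. real K * r ^ K) = real K ^ card J * r ^ (card J * K)"
    by (simp add: power_mult_distrib mult.commute flip: power_mult)
  ultimately show "(\<Prod>j\<in>J. real K * r ^ K)
      = real ((K + 1) ^ i * K ^ (card J - i)) * (r ^ (card J * K) * r ^ i)"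
    by simp
qed

lemma prod_le_balanced:
  fixes a :: "nat \<Rightarrow> nat" and K i :: nat
  assumes K: "K \<ge> 1" and i: "i \<le> card J" and s: "(\<Sum>j\<in>J. a j) = card J * K + i"
  shows "(\<Prod>j\<in>J. a j) \<le> (K + 1) ^ i * K ^ (card J - i)"
proof -
  define r where "r = real K / real (K + 1)"
  have "r > 0" using K by (simp add: r_def)
  have "(\<Prod>j\<in>J. real (a j) * r ^ a j) \<le> (\<Prod>j\<in>J. real K * r ^ K)"
    using geometric_weight_le[OF K] \<open>r > 0\<close> unfolding r_def by (intro prod_mono) simp
  then have "real (\<Prod>j\<in>J. a j) \<le> real ((K + 1) ^ i * K ^ (card J - i))"
    unfolding prod_eq_weighted_prod[OF K i s, folded r_def]
    using \<open>r > 0\<close> by (simp only: mult_le_cancel_right) (simp add: not_less)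
  then show ?thesis by (simp only: of_nat_le_iff)
qed

text \<open>A single factor outside \<open>{K, K + 1}\<close> already makes the weighted product strictly smaller
  than its bound, because the bound for each factor is positive.\<close>

lemma prod_balanced_imp:
  fixes a :: "nat \<Rightarrow> nat" and K i :: nat
  assumes J: "finite J"
    and K: "K \<ge> 1" and i: "i \<le> card J" and s: "(\<Sum>j\<in>J. a j) = card J * K + i"
    and ge: "(\<Prod>j\<in>J. a j) \<ge> (K + 1) ^ i * K ^ (card J - i)" and j: "j \<in> J"
  shows "a j = K \<or> a j = K + 1"
proof (rule ccontr)
  assume "\<not> (a j = K \<or> a j = K + 1)"
  define r where "r = real K / real (K + 1)"
  have r: "r > 0" using K by (simp add: r_def)
  have "real (a j) * r ^ a j < real K * r ^ K"
    using geometric_weight_less[OF K] \<open>\<not> _\<close> unfolding r_def by simp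
  moreover have "(\<Prod>j\<in>J - {j}. real (a j) * r ^ a j) \<le> (\<Prod>j\<in>J - {j}. real K * r ^ K)"
    using geometric_weight_le[OF K] r unfolding r_def by (intro prod_mono) simp
  moreover have "0 \<le> real (a j) * r ^ a j" "0 < (\<Prod>j\<in>J - {j}. real K * r ^ K)"
    using K r by (simp_all add: prod_pos)
  ultimately have "(\<Prod>j\<in>J. real (a j) * r ^ a j) < (\<Prod>j\<in>J. real K * r ^ K)"
    unfolding prod.remove[OF J j] by (meson le_less_trans mult_left_mono mult_strict_right_mono)
  then have "real (\<Prod>j\<in>J. a j) < real ((K + 1) ^ i * K ^ (card J - i))"
    unfolding prod_eq_weighted_prod[OF K i s, folded r_def]
    using r by (simp only: mult_less_cancel_right) (simp add: not_less)
  with ge show False by (simp only: of_nat_less_iff)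
qed

lemma sum_of_two_values:
  fixes a :: "nat \<Rightarrow> nat"
  assumes J: "finite J" and a: "\<And>j. j \<in> J \<Longrightarrow> a j = K \<or> a j = K + 1"
  shows "(\<Sum>j\<in>J. a j) = card J * K + card {j\<in>J. a j = K + 1}"
    and "card J = card {j\<in>J. a j = K + 1} + card {j\<in>J. a j = K}"
proof -
  have "(\<Sum>j\<in>J. a j) = (\<Sum>j\<in>J. K + (if a j = K + 1 then 1 else 0))"
    using a by (intro sum.cong) auto
  also have "\<dots> = card J * K + card {j\<in>J. a j = K + 1}"
    using J by (simp add: sum.distrib flip: sum.inter_filter)
  finally show "(\<Sum>j\<in>J. a j) = card J * K + card {j\<in>J. a j = K + 1}" .
  have "J = {j\<in>J. a j = K + 1} \<union> {j\<in>J. a j = K}" using a by auto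
  moreover have "card ({j\<in>J. a j = K + 1} \<union> {j\<in>J. a j = K})
      = card {j\<in>J. a j = K + 1} + card {j\<in>J. a j = K}"
    using J by (intro card_Un_disjoint) auto
  ultimately show "card J = card {j\<in>J. a j = K + 1} + card {j\<in>J. a j = K}" by metis
qed


section \<open>Coordinate sets\<close>

lemma proj_sum_eq: "proj_sum n A = (\<Sum>i=1..n. card ((\<lambda>x. x i) ` A))"
  unfolding proj_sum_def
proof (rule sum.cong)
  fix i assume i: "i \<in> {1..n}"
  define h where "h c = (\<lambda>j\<in>{1..n}. c * unit_vec n i j)" for c
  have "h c i = c" for c using i by (simp add: h_def unit_vec_def)
  then have "inj h" by (metis injI)
  moreover have "axis_proj n i ` A = h ` (\<lambda>x. x i) ` A"
    by (simp add: image_image axis_proj_def h_def)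
  ultimately show "card (axis_proj n i ` A) = card ((\<lambda>x. x i) ` A)"
    using card_image[of h] inj_on_subset by (metis subset_UNIV)
qed simp

lemma proj_sum_segment_eq:
  assumes "n \<ge> 1"
  shows "proj_sum_segment n m = (\<Sum>i=1..n. card ((\<lambda>x. x i) ` cube_segment n m))"
  unfolding proj_sum_segment_def proj_sum_eq
proof (rule sum.cong)
  fix i assume "i \<in> {1..n}"
  then have "(\<lambda>x. x i) ` real_vec n ` cube_segment n m = real ` (\<lambda>x. x i) ` cube_segment n m"
    by (simp add: image_image real_vec_def)
  then show "card ((\<lambda>x. x i) ` real_vec n ` cube_segment n m)
      = card ((\<lambda>x. x i) ` cube_segment n m)"
    by (simp add: card_image)
qed simp

lemma subset_PiE_coordinates:
  assumes "A \<subseteq> real_vecs n"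
  shows "A \<subseteq> PiE {1..n} (\<lambda>j. (\<lambda>x. x j) ` A)"
  using assms by (fastforce simp: real_vecs_def PiE_iff)

lemma coordinate_image_PiE:
  assumes "PiE J S \<noteq> {}" "j \<in> J"
  shows "(\<lambda>x. x j) ` PiE J S = S j"
proof -
  obtain x where "x \<in> PiE J S" using assms(1) by blast
  then have "x(j := c) \<in> PiE J S" if "c \<in> S j" for c
    using that assms(2) by (auto simp: PiE_iff extensional_def)
  then have "c \<in> (\<lambda>x. x j) ` PiE J S" if "c \<in> S j" for c
    using that by (intro image_eqI[of c _ "x(j := c)"]) simp_all
  then show ?thesis using assms(2) by blast
qed


section \<open>Initial segments of the cube order\<close>

lemma is_cube_segment_subset:
  assumes I: "is_cube_segment n m I" and J: "is_cube_segment n m' J" and "m \<le> m'"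
  shows "I \<subseteq> J"
proof (rule ccontr)
  assume "\<not> I \<subseteq> J"
  then obtain a where a: "a \<in> I" "a \<notin> J" by blast
  \<comment> \<open>An element of \<open>J\<close> cannot come after \<open>a\<close>, so it comes before \<open>a\<close>.\<close>
  have "J \<subseteq> I"
  proof
    fix b assume "b \<in> J"
    then have "a \<in> nat_vecs n" "b \<in> nat_vecs n" "a \<noteq> b"
      using I J a by (auto simp: is_cube_segment_def)
    then show "b \<in> I"
      using cube_less_total[of a n b] a \<open>b \<in> J\<close> I J unfolding is_cube_segment_def by blast
  qed
  with a have "J \<subset> I" by blast
  then have "card J < card I" using I psubset_card_mono by (metis is_cube_segment_def)
  with I J \<open>m \<le> m'\<close> show False by (simp add: is_cube_segment_def)
qed

abbreviation box_side :: "nat \<Rightarrow> nat \<Rightarrow> nat \<Rightarrow> nat set" where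
  "box_side K i j \<equiv> {..<if j \<le> i then K + 1 else K}"

lemma card_box_side_prod:
  assumes "i \<le> n"
  shows "(\<Prod>j=1..n. card (box_side K i j)) = (K + 1) ^ i * K ^ (n - i)"
proof -
  have "{1..n} = {1..i} \<union> {i+1..n}" using assms by auto
  then have "(\<Prod>j=1..n. card (box_side K i j))
      = (\<Prod>j=1..i. card (box_side K i j)) * (\<Prod>j=i+1..n. card (box_side K i j))"
    by (metis (no_types, lifting) finite_atLeastAtMost prod.union_disjoint
        ivl_disj_int_two(8) Suc_eq_plus1 atLeastSucAtMost_greaterThanAtMost)
  then show ?thesis by simp
qed

lemma card_box_side_sum:
  assumes "i \<le> n"
  shows "(\<Sum>j=1..n. card (box_side K i j)) = n * K + i"
proof -
  have "(\<Sum>j=1..n. card (box_side K i j))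
      = card {1..n} * K + card {j\<in>{1..n}. card (box_side K i j) = K + 1}"
    by (rule sum_of_two_values(1)) simp_all
  moreover have "{j\<in>{1..n}. card (box_side K i j) = K + 1} = {1..i}"
    using assms by (auto split: if_splits)
  ultimately show ?thesis by simp
qed

text \<open>The cube order first compares the places of the largest entries, from the last coordinate
  backwards. Passing from a vector of the box to an earlier one therefore never creates an entry
  above \<open>K\<close>, and an entry that newly becomes \<open>K\<close> stands before one that was \<open>K\<close>, hence within
  the first \<open>i\<close> coordinates.\<close>

lemma is_cube_segment_box:
  assumes "i \<le> n"
  shows "is_cube_segment n ((K + 1) ^ i * K ^ (n - i)) (PiE {1..n} (box_side K i))"
  unfolding is_cube_segment_def
proof (intro conjI ballI impI)
  show "card (PiE {1..n} (box_side K i)) = (K + 1) ^ i * K ^ (n - i)"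
    using card_box_side_prod[OF assms] by (simp add: card_PiE)
next
  fix y x
  assume y: "y \<in> PiE {1..n} (box_side K i)" and x: "x \<in> nat_vecs n" and "cube_less n x y"
  then obtain j where j: "j \<in> {1..n}" "x j < y j"
    "\<forall>k\<in>{1..n}. x k > y j \<or> y k > y j \<longrightarrow> x k = y k"
    "\<forall>k\<in>{1..n}. k > j \<longrightarrow> (x k = y j \<longleftrightarrow> y k = y j)"
    by (elim cube_lessE)
  have yk: "y k < (if k \<le> i then K + 1 else K)" if "k \<in> {1..n}" for k
    using PiE_mem[OF y that] by simp
  have "x k < (if k \<le> i then K + 1 else K)" if k: "k \<in> {1..n}" for k
  proof (cases "x k > y j \<or> (k > j \<and> x k = y j)")
    case True
    then have "x k = y k" using bspec[OF j(3) k] bspec[OF j(4) k] by auto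
    then show ?thesis using yk[OF k] by simp
  next
    case False
    \<comment> \<open>Now \<open>x k \<le> y j \<le> K\<close>; if both are equal to \<open>K\<close>, then \<open>k \<le> j \<le> i\<close>.\<close>
    then have "x k < y j \<or> (k \<le> j \<and> x k = y j)" by auto
    then show ?thesis using yk[OF j(1)] by (auto split: if_splits)
  qed
  with x show "x \<in> PiE {1..n} (box_side K i)" by (auto simp: nat_vecs_def PiE_iff)
qed (auto simp: nat_vecs_def intro!: finite_PiE)

lemma cube_segment_subset_box:
  assumes "n \<ge> 1" "i \<le> n" "m \<le> (K + 1) ^ i * K ^ (n - i)"
  shows "cube_segment n m \<subseteq> PiE {1..n} (box_side K i)"
  using is_cube_segment_subset is_cube_segment_cube_segment is_cube_segment_box assms by blast

lemma proj_sum_segment_le: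
  assumes "n \<ge> 1" "i \<le> n" "m \<le> (K + 1) ^ i * K ^ (n - i)"
  shows "proj_sum_segment n m \<le> n * K + i"
proof -
  have "card ((\<lambda>x. x j) ` cube_segment n m) \<le> card (box_side K i j)" if "j \<in> {1..n}" for j
    using cube_segment_subset_box[OF assms] PiE_mem[OF _ that, of _ "box_side K i"]
    by (intro card_mono) blast+
  then show ?thesis
    unfolding proj_sum_segment_eq[OF assms(1)] card_box_side_sum[OF assms(2), symmetric]
    by (rule sum_mono)
qed

lemma proj_sum_segment_balanced:
  assumes "n \<ge> 1" "i \<le> n" "K \<ge> 1"
  shows "proj_sum_segment n ((K + 1) ^ i * K ^ (n - i)) = n * K + i"
proof -
  have "cube_segment n ((K + 1) ^ i * K ^ (n - i)) = PiE {1..n} (box_side K i)"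
    using is_cube_segment_unique is_cube_segment_cube_segment is_cube_segment_box assms by blast
  moreover have ne: "PiE {1..n} (box_side K i) \<noteq> {}"
    using \<open>K \<ge> 1\<close> by (auto simp: PiE_eq_empty_iff lessThan_empty_iff bot_nat_def)
  ultimately have "proj_sum_segment n ((K + 1) ^ i * K ^ (n - i))
      = (\<Sum>j=1..n. card (box_side K i j))"
    unfolding proj_sum_segment_eq[OF assms(1)]
    using coordinate_image_PiE[OF ne] by (intro sum.cong) simp_all
  then show ?thesis using card_box_side_sum[OF assms(2)] by simp
qed


section \<open>The isoperimetric inequality and its equality case\<close>

lemma proj_sum_ge_segment:
  assumes n: "n \<ge> 1" and A: "A \<subseteq> real_vecs n" "finite A"
  shows "proj_sum_segment n (card A) \<le> proj_sum n A"
proof (cases "A = {}")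
  case True
  \<comment> \<open>The box with \<open>K = i = 0\<close> is empty.\<close>
  then have "proj_sum_segment n (card A) \<le> n * 0 + 0"
    using n by (intro proj_sum_segment_le) simp_all
  then show ?thesis by simp
next
  case False
  define a where "a j = card ((\<lambda>x. x j) ` A)" for j
  define K where "K = proj_sum n A div n"
  define i where "i = proj_sum n A mod n"
  have sum: "(\<Sum>j\<in>{1..n}. a j) = proj_sum n A" by (simp add: proj_sum_eq a_def)
  have "n \<le> proj_sum n A"
  proof -
    have "1 \<le> a j" for j using False A(2) by (simp add: a_def Suc_le_eq card_gt_0_iff)
    then have "(\<Sum>j\<in>{1..n}. 1) \<le> (\<Sum>j\<in>{1..n}. a j)" by (intro sum_mono)
    with sum show ?thesis by simp
  qed
  then have K: "K \<ge> 1" using n by (simp add: K_def Suc_le_eq div_greater_zero_iff)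
  have i: "i \<le> n" using n by (simp add: i_def less_imp_le)
  have s: "proj_sum n A = n * K + i" by (simp add: K_def i_def)
  have "card A \<le> card (PiE {1..n} (\<lambda>j. (\<lambda>x. x j) ` A))"
    using subset_PiE_coordinates A by (intro card_mono finite_PiE) auto
  also have "\<dots> = (\<Prod>j\<in>{1..n}. a j)" by (simp add: card_PiE a_def)
  also have "\<dots> \<le> (K + 1) ^ i * K ^ (n - i)"
    using prod_le_balanced[of K i "{1..n}" a] K i sum s by simp
  finally show ?thesis using proj_sum_segment_le[OF n i] s by simp
qed

lemma proj_sum_balanced_imp_product:
  assumes A: "A \<subseteq> real_vecs n" "finite A"
    and K: "K \<ge> 1" and i: "i \<le> n" and m: "card A = (K + 1) ^ i * K ^ (n - i)"
    and s: "proj_sum n A = n * K + i"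
  shows "\<exists>S. A = PiE {1..n} S \<and> card {j\<in>{1..n}. card (S j) = K + 1} = i \<and>
    card {j\<in>{1..n}. card (S j) = K} = n - i"
proof -
  define S where "S j = (\<lambda>x. x j) ` A" for j
  have sum: "(\<Sum>j\<in>{1..n}. card (S j)) = card {1..n} * K + i"
    using s by (simp add: proj_sum_eq S_def)
  have "A \<subseteq> PiE {1..n} S" using subset_PiE_coordinates[OF A(1)] unfolding S_def .
  moreover have fin: "finite (PiE {1..n} S)" using A(2) by (intro finite_PiE) (auto simp: S_def)
  ultimately have "card A \<le> card (PiE {1..n} S)" by (intro card_mono)
  then have ge: "(K + 1) ^ i * K ^ (card {1..n} - i) \<le> (\<Prod>j\<in>{1..n}. card (S j))"
    using m by (simp add: card_PiE)
  have two: "card (S j) = K \<or> card (S j) = K + 1" if "j \<in> {1..n}" for j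
    by (rule prod_balanced_imp[OF _ K _ sum ge that]) (use i in simp_all)
  have "card (PiE {1..n} S) \<le> card A"
    using prod_le_balanced[OF K _ sum] i m by (simp add: card_PiE)
  with \<open>A \<subseteq> PiE {1..n} S\<close> fin have "A = PiE {1..n} S" by (simp add: card_seteq)
  moreover have "card {j\<in>{1..n}. card (S j) = K + 1} = i"
    using sum_of_two_values(1)[of "{1..n}" "\<lambda>j. card (S j)" K] two sum by simp
  moreover from this have "card {j\<in>{1..n}. card (S j) = K} = n - i"
    using sum_of_two_values(2)[of "{1..n}" "\<lambda>j. card (S j)" K] two by simp
  ultimately show ?thesis by blast
qed

lemma proj_sum_product:
  assumes K: "K \<ge> 1" and i: "i \<le> n"
    and large: "card {j\<in>{1..n}. card (S j) = K + 1} = i"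
    and small: "card {j\<in>{1..n}. card (S j) = K} = n - i"
  shows "proj_sum n (PiE {1..n} S) = n * K + i"
proof -
  \<comment> \<open>The two index sets are disjoint and have \<open>n\<close> elements in all, so they exhaust \<open>{1..n}\<close>.\<close>
  have "card ({j\<in>{1..n}. card (S j) = K + 1} \<union> {j\<in>{1..n}. card (S j) = K}) = n"
    using large small i by (subst card_Un_disjoint) auto
  then have "{j\<in>{1..n}. card (S j) = K + 1} \<union> {j\<in>{1..n}. card (S j) = K} = {1..n}"
    by (intro card_subset_eq) auto
  then have two: "card (S j) = K \<or> card (S j) = K + 1" if "j \<in> {1..n}" for j
    using that by blast
  then have "S j \<noteq> {}" if "j \<in> {1..n}" for j using that K by fastforce
  then have "PiE {1..n} S \<noteq> {}" by (simp add: PiE_eq_empty_iff)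
  then have "proj_sum n (PiE {1..n} S) = (\<Sum>j=1..n. card (S j))"
    by (simp add: proj_sum_eq coordinate_image_PiE)
  also have "\<dots> = n * K + i"
    using sum_of_two_values(1)[of "{1..n}" "\<lambda>j. card (S j)" K] two large by simp
  finally show ?thesis .
qed

theorem theorem4:
  fixes n :: nat and A :: "(nat \<Rightarrow> real) set"
  assumes "n \<ge> 1" and "A \<subseteq> real_vecs n" and "finite A"
  shows "proj_sum n A \<ge> proj_sum_segment n (card A) \<and>
    (\<forall>K i :: nat. K \<ge> 1 \<and> i \<le> n \<and> card A = (K + 1) ^ i * K ^ (n - i) \<longrightarrow>
      (proj_sum n A = proj_sum_segment n (card A) \<longleftrightarrow>
        (\<exists>S :: nat \<Rightarrow> real set.
           A = PiE {1..n} S \<and>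
           card {j\<in>{1..n}. card (S j) = K + 1} = i \<and>
           card {j\<in>{1..n}. card (S j) = K} = n - i)))"
proof (intro conjI allI impI)
  show "proj_sum n A \<ge> proj_sum_segment n (card A)"
    using proj_sum_ge_segment[OF assms] .
next
  fix K i :: nat
  assume *: "K \<ge> 1 \<and> i \<le> n \<and> card A = (K + 1) ^ i * K ^ (n - i)"
  then have "proj_sum_segment n (card A) = n * K + i"
    using proj_sum_segment_balanced[OF assms(1)] by simp
  moreover have "proj_sum n A = n * K + i \<longleftrightarrow>
        (\<exists>S :: nat \<Rightarrow> real set.
           A = PiE {1..n} S \<and>
           card {j\<in>{1..n}. card (S j) = K + 1} = i \<and>
           card {j\<in>{1..n}. card (S j) = K} = n - i)"
    using * proj_sum_balanced_imp_product[OF assms(2,3), of K i] proj_sum_product[of K i n]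
    by blast
  ultimately show "proj_sum n A = proj_sum_segment n (card A) \<longleftrightarrow>
        (\<exists>S :: nat \<Rightarrow> real set.
           A = PiE {1..n} S \<and>
           card {j\<in>{1..n}. card (S j) = K + 1} = i \<and>
           card {j\<in>{1..n}. card (S j) = K} = n - i)"
    by simp
qed

end
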